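(* Let $m\ge1$, $t\ge0$, $N_T\ge0$ be integers, let $\mathcal Q_1,\mathcal Q_2\subset\mathcal Q(N_T,m)$, and suppose $\mathcal D(u_1,u_2)>t$ for all $u_1\in\mathcal Q_1$ and $u_2\in\mathcal Q_2$. Let $|c_{l_1}\rangle$ be a superposition of the states $|u\rangle$, $u\in\mathcal Q_1$, and $|c_{l_2}\rangle$ a superposition of the states $|u\rangle$, $u\in\mathcal Q_2$. Then $$\langle c_{l_1}|A_{\tilde k}^\dagger A_{\tilde k'}|c_{l_2}\rangle=0\qquad\text{for all }\tilde k,\tilde k'\in\bigcup_{s\le t}\mathcal K(s).$$
   Context: $\mathcal Q(N_T,m)$ is the set of $m$-tuples $u=(u_1,\dots,u_m)$ of non-negative integers with $\sum_iu_i=N_T$, identified with the number states $|u\rangle=|u_1\rangle\otimes\cdots\otimes|u_m\rangle$ of $m$ registers, each with orthonormal basis $|0\rangle,\dots,|N\rangle$ ($N\ge N_T$). The distance on $\mathcal Q(N_T,m)$ is $\mathcal D(u,v)=\frac12\sum_i|u_i-v_i|$. For fixed $0<\gamma<1$, the amplitude damping operators on one register are $A_k=\sum_{n=k}^{N}\sqrt{\binom nk}\sqrt{(1-\gamma)^{n-k}\gamma^k}\,|n-k\rangle\langle n|$, and for $\tilde k=(k_1,\dots,k_m)$ with $0\le k_j\le N$, $A_{\tilde k}=A_{k_1}\otimes\cdots\otimes A_{k_m}$. $\mathcal K(s)$ is the set of $\tilde k$ with $k_1+\cdots+k_m=s$. *)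

theory Defs
  imports Complex_Main "Jordan_Normal_Form.VS_Connect"
    "Jordan_Normal_Form.Schur_Decomposition"
begin

text \<open>Tuples \<open>(u\<^sub>1, \<dots>, u\<^sub>m)\<close> are lists of length \<open>m\<close>.\<close>

definition number_tuples :: "nat \<Rightarrow> nat \<Rightarrow> nat list set" where
  "number_tuples NT m = {u. length u = m \<and> sum_list u = NT}"

definition tuple_dist :: "nat list \<Rightarrow> nat list \<Rightarrow> real" where
  "tuple_dist u v = 1 / 2 * (\<Sum>i<length u. \<bar>real (u ! i) - real (v ! i)\<bar>)"

text \<open>Tensor products are Kronecker products: the basis vector \<open>e\<^sub>i \<otimes> e\<^sub>j\<close> of the product with
  a \<open>d\<close>-dimensional second factor has index \<open>i * d + j\<close>. The empty product is the one-dimensional unit.\<close>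

definition kron_vec :: "'a::semiring_1 vec \<Rightarrow> 'a vec \<Rightarrow> 'a vec" where
  "kron_vec v w = vec (dim_vec v * dim_vec w)
     (\<lambda>i. v $ (i div dim_vec w) * w $ (i mod dim_vec w))"

definition kron_mat :: "'a::semiring_1 mat \<Rightarrow> 'a mat \<Rightarrow> 'a mat" where
  "kron_mat A B = mat (dim_row A * dim_row B) (dim_col A * dim_col B)
     (\<lambda>(i, j). A $$ (i div dim_row B, j div dim_col B) * B $$ (i mod dim_row B, j mod dim_col B))"

definition tensor_vecs :: "'a::semiring_1 vec list \<Rightarrow> 'a vec" where
  "tensor_vecs vs = foldr kron_vec vs (vec 1 (\<lambda>_. 1))"

definition tensor_mats :: "'a::semiring_1 mat list \<Rightarrow> 'a mat" where
  "tensor_mats As = foldr kron_mat As (1\<^sub>m 1)"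

text \<open>One register is \<open>\<complex>\<^bsup>N+1\<^esup>\<close> with \<open>|n\<rangle>\<close> the unit vector of index \<open>n\<close>.\<close>

definition number_state :: "nat \<Rightarrow> nat list \<Rightarrow> complex vec" where
  "number_state N u = tensor_vecs (map (unit_vec (N + 1)) u)"

text \<open>The conditional factor is the \<open>(i, j)\<close> entry of \<open>|n - k\<rangle>\<langle>n|\<close>.\<close>

definition damping_op :: "real \<Rightarrow> nat \<Rightarrow> nat \<Rightarrow> complex mat" where
  "damping_op \<gamma> N k = mat (N + 1) (N + 1) (\<lambda>(i, j).
     \<Sum>n = k..N. complex_of_real (sqrt (real (n choose k)) * sqrt ((1 - \<gamma>) ^ (n - k) * \<gamma> ^ k))
       * (if i = n - k \<and> j = n then 1 else 0))"

definition damping_ops :: "real \<Rightarrow> nat \<Rightarrow> nat list \<Rightarrow> complex mat" where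
  "damping_ops \<gamma> N ks = tensor_mats (map (damping_op \<gamma> N) ks)"

definition error_indices :: "nat \<Rightarrow> nat \<Rightarrow> nat \<Rightarrow> nat list set" where
  "error_indices N m s = {ks. length ks = m \<and> (\<forall>k\<in>set ks. k \<le> N) \<and> sum_list ks = s}"

definition superpositions :: "nat \<Rightarrow> nat \<Rightarrow> nat list set \<Rightarrow> complex vec set" where
  "superpositions N m Q = LinearCombinations.module.span class_ring
     (module_vec TYPE(complex) ((N + 1) ^ m)) (number_state N ` Q)"

text \<open>The library's \<open>\<bullet>c\<close> conjugates its second argument, whereas the bracket \<open>\<langle>x|y\<rangle>\<close> is
  conjugate-linear in \<open>x\<close>.\<close>

definition braket :: "complex vec \<Rightarrow> complex vec \<Rightarrow> complex" where
  "braket x y = y \<bullet>c x"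

end

theory Submission
  imports Defs
begin

text \<open>Moving the adjoint across the bracket and using bilinearity, it suffices to treat number states
  \<open>|u\<rangle>\<close>, \<open>|v\<rangle>\<close>. There \<open>\<langle>u|A\<^sub>k\<^sup>\<dagger> A\<^sub>k\<^sub>'|v\<rangle>\<close> factors over the registers, and a
  factor is nonzero only if the damped states coincide, \<open>u\<^sub>i - k\<^sub>i = v\<^sub>i - k'\<^sub>i\<close>, hence
  \<open>\<bar>u\<^sub>i - v\<^sub>i\<bar> \<le> k\<^sub>i + k'\<^sub>i\<close>. If no factor vanishes, summation bounds the distance of \<open>u\<close>
  and \<open>v\<close> by \<open>t\<close>.\<close>

section \<open>Kronecker products of two factors\<close>

text \<open>The range splits into \<open>a\<close> consecutive blocks of length \<open>b\<close>. On
  block \<open>k\<close> the quotient is constantly \<open>k\<close>, while the remainder runs once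
  through all residues. This is how a sum over a Kronecker index factors into sums over the two
  component indices.\<close>

lemma sum_div_mod_product:
  fixes f g :: "nat \<Rightarrow> 'a::comm_semiring_1"
  shows "(\<Sum>i<a * b. f (i div b) * g (i mod b)) = (\<Sum>i<a. f i) * (\<Sum>j<b. g j)"
proof -
  have block: "(\<Sum>i = k * b..<k * b + b. f (i div b) * g (i mod b)) = f k * (\<Sum>j<b. g j)" for k
  proof -
    have "(\<Sum>i = k * b..<k * b + b. f (i div b) * g (i mod b))
        = (\<Sum>j = 0..<b. f ((j + k * b) div b) * g ((j + k * b) mod b))"
      using sum.shift_bounds_nat_ivl[of "\<lambda>i. f (i div b) * g (i mod b)" 0 "k * b" b] by (simp add: add.commute)
    also have "\<dots> = (\<Sum>j = 0..<b. f k * g j)"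
      by (intro sum.cong) auto
    finally show ?thesis
      by (simp add: sum_distrib_left lessThan_atLeast0)
  qed
  show ?thesis
    using sum.nat_group[of "\<lambda>i. f (i div b) * g (i mod b)" b a]
    by (simp add: block sum_distrib_right)
qed

lemma div_mod_bounds:
  fixes i a b :: nat
  assumes "i < a * b"
  shows "i div b < a" "i mod b < b"
  using assms by (auto simp: less_mult_imp_div_less intro!: mod_less_divisor gr0I)

text \<open>Mixed-product rule: the column index of the matrix and the index of the vector are
  decoded by the same divisor, so the sum in each entry splits by
  \<open>sum_div_mod_product\<close>.\<close>

lemma kron_mat_mult_kron_vec:
  fixes A B :: "'a::comm_ring_1 mat"
  assumes "dim_col A = dim_vec v" and "dim_col B = dim_vec w"
  shows "kron_mat A B *\<^sub>v kron_vec v w = kron_vec (A *\<^sub>v v) (B *\<^sub>v w)"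
proof (rule eq_vecI)
  fix i assume "i < dim_vec (kron_vec (A *\<^sub>v v) (B *\<^sub>v w))"
  then have i: "i < dim_row A * dim_row B"
    by (simp add: kron_vec_def)
  note b = div_mod_bounds[OF i]
  have "(kron_mat A B *\<^sub>v kron_vec v w) $ i
      = (\<Sum>j<dim_vec v * dim_vec w.
          (A $$ (i div dim_row B, j div dim_vec w) * v $ (j div dim_vec w))
          * (B $$ (i mod dim_row B, j mod dim_vec w) * w $ (j mod dim_vec w)))"
    using i assms
    by (auto simp: kron_mat_def kron_vec_def scalar_prod_def lessThan_atLeast0 mult_ac
        intro!: sum.cong)
  also have "\<dots> = (\<Sum>j<dim_vec v. A $$ (i div dim_row B, j) * v $ j)
      * (\<Sum>j<dim_vec w. B $$ (i mod dim_row B, j) * w $ j)"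
    by (rule sum_div_mod_product)
  also have "\<dots> = kron_vec (A *\<^sub>v v) (B *\<^sub>v w) $ i"
    using i b assms by (simp add: kron_vec_def scalar_prod_def lessThan_atLeast0)
  finally show "(kron_mat A B *\<^sub>v kron_vec v w) $ i = kron_vec (A *\<^sub>v v) (B *\<^sub>v w) $ i" .
qed (simp add: kron_mat_def kron_vec_def)

lemma cscalar_prod_kron_vec:
  fixes v w v' w' :: "complex vec"
  assumes "dim_vec v = dim_vec v'" and "dim_vec w = dim_vec w'"
  shows "kron_vec v w \<bullet>c kron_vec v' w' = (v \<bullet>c v') * (w \<bullet>c w')"
proof -
  have "kron_vec v w \<bullet>c kron_vec v' w'
      = (\<Sum>j<dim_vec v' * dim_vec w'.
          (v $ (j div dim_vec w') * cnj (v' $ (j div dim_vec w')))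
          * (w $ (j mod dim_vec w') * cnj (w' $ (j mod dim_vec w'))))"
    using assms
    by (auto simp: kron_vec_def scalar_prod_def lessThan_atLeast0 mult_ac intro!: sum.cong)
  also have "\<dots> = (\<Sum>j<dim_vec v'. v $ j * cnj (v' $ j)) * (\<Sum>j<dim_vec w'. w $ j * cnj (w' $ j))"
    by (rule sum_div_mod_product)
  finally show ?thesis
    by (simp add: scalar_prod_def lessThan_atLeast0)
qed

section \<open>Tensor products over a list of registers\<close>

lemma dim_tensor_mats:
  "dim_row (tensor_mats As) = prod_list (map dim_row As)"
  "dim_col (tensor_mats As) = prod_list (map dim_col As)"
  by (induction As) (auto simp: tensor_mats_def kron_mat_def)

lemma dim_tensor_vecs: "dim_vec (tensor_vecs vs) = prod_list (map dim_vec vs)"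
  by (induction vs) (auto simp: tensor_vecs_def kron_vec_def)

lemma tensor_mats_mult_tensor_vecs:
  fixes As :: "'a::comm_ring_1 mat list"
  assumes "list_all2 (\<lambda>A v. dim_col A = dim_vec v) As vs"
  shows "tensor_mats As *\<^sub>v tensor_vecs vs = tensor_vecs (map2 (*\<^sub>v) As vs)"
  using assms
proof (induction rule: list_all2_induct)
  case Nil
  show ?case
    by (auto simp: tensor_mats_def tensor_vecs_def)
next
  case (Cons A As v vs)
  \<comment> \<open>The two-factor rule needs matching dimensions for the tails as well; these are
    products of the individual dimensions, which agree pairwise.\<close>
  have "map dim_col As = map dim_vec vs"
    using Cons.hyps(2) by (induction rule: list_all2_induct) auto
  then have "dim_col (tensor_mats As) = dim_vec (tensor_vecs vs)"
    by (simp add: dim_tensor_mats dim_tensor_vecs)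
  with Cons show ?case
    using kron_mat_mult_kron_vec[of A v "tensor_mats As" "tensor_vecs vs"]
    by (simp add: tensor_mats_def tensor_vecs_def)
qed

lemma cscalar_prod_tensor_vecs:
  fixes vs ws :: "complex vec list"
  assumes "list_all2 (\<lambda>v w. dim_vec v = dim_vec w) vs ws"
  shows "tensor_vecs vs \<bullet>c tensor_vecs ws = prod_list (map2 (\<bullet>c) vs ws)"
  using assms
proof (induction rule: list_all2_induct)
  case Nil
  show ?case
    by (simp add: tensor_vecs_def scalar_prod_def)
next
  case (Cons v vs w ws)
  have "map dim_vec vs = map dim_vec ws"
    using Cons.hyps(2) by (induction rule: list_all2_induct) auto
  then have "dim_vec (tensor_vecs vs) = dim_vec (tensor_vecs ws)"
    by (simp add: dim_tensor_vecs)
  with Cons show ?case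
    using cscalar_prod_kron_vec[of v w "tensor_vecs vs" "tensor_vecs ws"]
    by (simp add: tensor_vecs_def)
qed

section \<open>Overlaps of damped number states\<close>

text \<open>The operator with index \<open>k\<close> lowers a level by exactly \<open>k\<close> and
  annihilates levels below \<open>k\<close>. The additive form \<open>u = i + k\<close> also records
  \<open>k \<le> u\<close>, which truncated subtraction would lose.\<close>

lemma damping_op_unit_vec_nonzeroD:
  assumes "i \<le> N" and "(damping_op \<gamma> N k *\<^sub>v unit_vec (N + 1) u) $ i \<noteq> 0"
  shows "u = i + k"
proof -
  have "(\<Sum>j = 0..<N + 1. damping_op \<gamma> N k $$ (i, j) * unit_vec (N + 1) u $ j) \<noteq> 0"
    using assms by (simp add: damping_op_def scalar_prod_def)
  then obtain j where "j \<in> {0..<N + 1}"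
    and nz: "damping_op \<gamma> N k $$ (i, j) * unit_vec (N + 1) u $ j \<noteq> 0"
    by (rule sum.not_neutral_contains_not_neutral)
  then have j: "j < N + 1"
    by simp
  with nz have "damping_op \<gamma> N k $$ (i, j) \<noteq> 0" and "j = u"
    by (auto simp: unit_vec_def split: if_splits)
  let ?c = "\<lambda>n. complex_of_real (sqrt (real (n choose k)) * sqrt ((1 - \<gamma>) ^ (n - k) * \<gamma> ^ k))"
  have "(\<Sum>n = k..N. ?c n * (if i = n - k \<and> j = n then 1 else 0)) \<noteq> 0"
    using \<open>damping_op \<gamma> N k $$ (i, j) \<noteq> 0\<close> assms(1) j unfolding damping_op_def by simp
  then obtain n where "n \<in> {k..N}" and "?c n * (if i = n - k \<and> j = n then 1 else 0) \<noteq> 0"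
    by (rule sum.not_neutral_contains_not_neutral)
  \<comment> \<open>The summation range supplies \<open>k \<le> n\<close>, so the truncated
    difference \<open>n - k\<close> is exact.\<close>
  then have "k \<le> n" and "i = n - k" and "j = n"
    by (auto split: if_splits)
  with \<open>j = u\<close> show ?thesis
    by auto
qed

text \<open>A nonzero overlap needs an index \<open>i\<close> in both supports, whence
  \<open>u - v = k - k'\<close> over the reals. The primed vector comes first because
  \<open>braket\<close> swaps the arguments of \<open>\<bullet>c\<close>.\<close>

lemma damped_unit_vecs_overlapD:
  assumes "(damping_op \<gamma> N k' *\<^sub>v unit_vec (N + 1) v) \<bullet>c (damping_op \<gamma> N k *\<^sub>v unit_vec (N + 1) u) \<noteq> 0"
  shows "\<bar>real u - real v\<bar> \<le> real k + real k'"
proof -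
  let ?x = "damping_op \<gamma> N k' *\<^sub>v unit_vec (N + 1) v"
  let ?y = "damping_op \<gamma> N k *\<^sub>v unit_vec (N + 1) u"
  have "dim_vec ?y = N + 1"
    by (simp add: damping_op_def)
  then have "?x \<bullet>c ?y = (\<Sum>i = 0..<N + 1. ?x $ i * cnj (?y $ i))"
    unfolding scalar_prod_def by (intro sum.cong) auto
  with assms have "(\<Sum>i = 0..<N + 1. ?x $ i * cnj (?y $ i)) \<noteq> 0"
    by metis
  then obtain i where "i \<in> {0..<N + 1}" and "?x $ i * cnj (?y $ i) \<noteq> 0"
    by (rule sum.not_neutral_contains_not_neutral)
  then have "i \<le> N" and "?x $ i \<noteq> 0" and "?y $ i \<noteq> 0"
    by auto
  then have "v = i + k'" and "u = i + k"
    using damping_op_unit_vec_nonzeroD by blast+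
  then show ?thesis
    by simp
qed

lemma damping_ops_number_state:
  assumes "length ks = length u"
  shows "damping_ops \<gamma> N ks *\<^sub>v number_state N u
    = tensor_vecs (map2 (\<lambda>k n. damping_op \<gamma> N k *\<^sub>v unit_vec (N + 1) n) ks u)"
proof -
  have "list_all2 (\<lambda>A v. dim_col A = dim_vec v) (map (damping_op \<gamma> N) ks) (map (unit_vec (N + 1)) u)"
    using assms by (auto simp: list_all2_conv_all_nth damping_op_def)
  from tensor_mats_mult_tensor_vecs[OF this] show ?thesis
    by (simp add: damping_ops_def number_state_def zip_map_map case_prod_unfold o_def)
qed

text \<open>The overlap is a product over the registers, so the bound holds in every register and
  can be summed. Doubling the distance cancels the factor 1/2 in \<open>tuple_dist\<close>.\<close>

lemma tuple_dist_le_if_damped_overlap: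
  assumes "length u = m" "length v = m" "length k = m" "length k' = m"
    and "(damping_ops \<gamma> N k' *\<^sub>v number_state N v) \<bullet>c (damping_ops \<gamma> N k *\<^sub>v number_state N u) \<noteq> 0"
  shows "2 * tuple_dist u v \<le> real (sum_list k + sum_list k')"
proof -
  let ?F = "\<lambda>k n. damping_op \<gamma> N k *\<^sub>v unit_vec (N + 1) n"
  let ?xs = "map2 ?F k' v" and ?ys = "map2 ?F k u"
  have "list_all2 (\<lambda>v w. dim_vec v = dim_vec w) ?xs ?ys"
    using assms by (auto simp: list_all2_conv_all_nth damping_op_def)
  from cscalar_prod_tensor_vecs[OF this] have nz: "prod_list (map2 (\<bullet>c) ?xs ?ys) \<noteq> 0"
    using assms by (simp add: damping_ops_number_state)
  have "\<bar>real (u ! i) - real (v ! i)\<bar> \<le> real (k ! i) + real (k' ! i)" if "i < m" for i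
  proof (rule damped_unit_vecs_overlapD)
    have "map2 (\<bullet>c) ?xs ?ys ! i \<in> set (map2 (\<bullet>c) ?xs ?ys)"
      using assms that by (intro nth_mem) simp
    \<comment> \<open>A product of complex numbers is nonzero only if each factor is.\<close>
    then have "map2 (\<bullet>c) ?xs ?ys ! i \<noteq> 0"
      using nz by (metis prod_list_zero_iff)
    then show "?F (k' ! i) (v ! i) \<bullet>c ?F (k ! i) (u ! i) \<noteq> 0"
      using assms that by simp
  qed
  then have "(\<Sum>i<m. \<bar>real (u ! i) - real (v ! i)\<bar>) \<le> (\<Sum>i<m. real (k ! i) + real (k' ! i))"
    by (intro sum_mono) simp
  also have "\<dots> = real (sum_list k + sum_list k')"
    using assms by (simp add: sum.distrib sum_list_sum_nth lessThan_atLeast0)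
  finally show ?thesis
    using assms by (simp add: tuple_dist_def)
qed

section \<open>Adjoints and passage from generators to spans\<close>

lemma cscalar_prod_mat_adjoint:
  fixes A :: "complex mat"
  assumes A: "A \<in> carrier_mat n n" and y: "y \<in> carrier_vec n" and w: "w \<in> carrier_vec n"
  shows "(mat_adjoint A *\<^sub>v y) \<bullet>c w = y \<bullet>c (A *\<^sub>v w)"
proof -
  have adj: "mat_adjoint A $$ (i, j) = cnj (A $$ (j, i))" if "i < n" "j < n" for i j
    using that A by (simp add: mat_adjoint_def mat_of_rows_def)
  have dim: "dim_row (mat_adjoint A) = n" "dim_col (mat_adjoint A) = n"
    using A by (auto simp: mat_adjoint_def)
  have "(mat_adjoint A *\<^sub>v y) \<bullet>c w = (\<Sum>i = 0..<n. (\<Sum>j = 0..<n. cnj (A $$ (j, i)) * y $ j) * cnj (w $ i))"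
    using y w by (simp add: scalar_prod_def dim adj)
  also have "\<dots> = (\<Sum>i = 0..<n. \<Sum>j = 0..<n. y $ j * cnj (A $$ (j, i) * w $ i))"
    by (simp add: sum_distrib_right sum_distrib_left mult_ac)
  also have "\<dots> = (\<Sum>j = 0..<n. \<Sum>i = 0..<n. y $ j * cnj (A $$ (j, i) * w $ i))"
    by (rule sum.swap)
  also have "\<dots> = y \<bullet>c (A *\<^sub>v w)"
    using A w by (simp add: scalar_prod_def sum_distrib_left)
  finally show ?thesis .
qed

text \<open>The carrier vectors satisfying \<open>P\<close> form a submodule containing
  \<open>S\<close>, and the span lies in every such submodule.\<close>

lemma span_inductive:
  fixes S :: "complex vec set"
  assumes "x \<in> LinearCombinations.module.span class_ring (module_vec TYPE(complex) n) S"
    and "S \<subseteq> carrier_vec n"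
    and "P (0\<^sub>v n)"
    and "\<And>v. v \<in> S \<Longrightarrow> P v"
    and "\<And>v w. v \<in> carrier_vec n \<Longrightarrow> w \<in> carrier_vec n \<Longrightarrow> P v \<Longrightarrow> P w \<Longrightarrow> P (v + w)"
    and "\<And>c v. v \<in> carrier_vec n \<Longrightarrow> P v \<Longrightarrow> P (c \<cdot>\<^sub>v v)"
  shows "P x"
proof -
  interpret vec_space "TYPE(complex)" n .
  have "submodule class_ring {v \<in> carrier_vec n. P v} V"
    using assms by unfold_locales auto
  then have "span S \<subseteq> {v \<in> carrier_vec n. P v}"
    using assms by (intro span_is_subset) auto
  with assms(1) show ?thesis
    by auto
qed

text \<open>Two nested span inductions: first \<open>y\<close> varies against a fixed generator
  \<open>v\<close>, then \<open>x\<close> varies against the fixed \<open>y\<close>. The form is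
  only conjugate-linear in \<open>x\<close>, but scaling by a conjugated factor still preserves
  vanishing.\<close>

lemma span_orthogonal_images:
  fixes A B :: "complex mat"
  assumes A: "A \<in> carrier_mat n n" and B: "B \<in> carrier_mat n n"
    and S: "S \<subseteq> carrier_vec n" and T: "T \<subseteq> carrier_vec n"
    and orth: "\<And>v w. v \<in> S \<Longrightarrow> w \<in> T \<Longrightarrow> (B *\<^sub>v w) \<bullet>c (A *\<^sub>v v) = 0"
    and x: "x \<in> LinearCombinations.module.span class_ring (module_vec TYPE(complex) n) S"
    and y: "y \<in> LinearCombinations.module.span class_ring (module_vec TYPE(complex) n) T"
  shows "(B *\<^sub>v y) \<bullet>c (A *\<^sub>v x) = 0"
proof -
  have carrier: "A *\<^sub>v v \<in> carrier_vec n" "B *\<^sub>v v \<in> carrier_vec n" if "v \<in> carrier_vec n" for v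
    using A B that by auto
  have zero: "M *\<^sub>v 0\<^sub>v n = 0\<^sub>v n" if "M \<in> carrier_mat n n" for M :: "complex mat"
    using that by (intro eq_vecI) auto
  have step: "(B *\<^sub>v y) \<bullet>c (A *\<^sub>v v) = 0" if "v \<in> S" for v
  proof (rule span_inductive[OF y T])
    have v: "conjugate (A *\<^sub>v v) \<in> carrier_vec n"
      using S that carrier by auto
    show "(B *\<^sub>v 0\<^sub>v n) \<bullet>c (A *\<^sub>v v) = 0"
      using v by (simp add: zero[OF B])
    show "(B *\<^sub>v w) \<bullet>c (A *\<^sub>v v) = 0" if "w \<in> T" for w
      using orth \<open>v \<in> S\<close> that by blast
    show "(B *\<^sub>v (w + z)) \<bullet>c (A *\<^sub>v v) = 0"
      if "w \<in> carrier_vec n" "z \<in> carrier_vec n"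
        "(B *\<^sub>v w) \<bullet>c (A *\<^sub>v v) = 0" "(B *\<^sub>v z) \<bullet>c (A *\<^sub>v v) = 0" for w z
      using that B carrier v
      by (simp add: mult_add_distrib_mat_vec add_scalar_prod_distrib[of _ n])
    show "(B *\<^sub>v (c \<cdot>\<^sub>v w)) \<bullet>c (A *\<^sub>v v) = 0"
      if "w \<in> carrier_vec n" "(B *\<^sub>v w) \<bullet>c (A *\<^sub>v v) = 0" for c w
      using that carrier v by (simp add: mult_mat_vec[OF B] smult_scalar_prod_distrib[of _ n])
  qed
  \<comment> \<open>Carrier membership is closed under linear combinations, so it follows by the
    same induction.\<close>
  have "y \<in> carrier_vec n"
    by (rule span_inductive[OF y T]) (use T in auto)
  then have By: "B *\<^sub>v y \<in> carrier_vec n"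
    by (rule carrier)
  show ?thesis
  proof (rule span_inductive[OF x S])
    show "(B *\<^sub>v y) \<bullet>c (A *\<^sub>v 0\<^sub>v n) = 0"
      using By by (simp add: zero[OF A])
    show "(B *\<^sub>v y) \<bullet>c (A *\<^sub>v v) = 0" if "v \<in> S" for v
      using step that .
    show "(B *\<^sub>v y) \<bullet>c (A *\<^sub>v (w + z)) = 0"
      if "w \<in> carrier_vec n" "z \<in> carrier_vec n"
        "(B *\<^sub>v y) \<bullet>c (A *\<^sub>v w) = 0" "(B *\<^sub>v y) \<bullet>c (A *\<^sub>v z) = 0" for w z
      using that A carrier By
      by (simp add: mult_add_distrib_mat_vec conjugate_add_vec[of _ n] scalar_prod_add_distrib[of _ n])
    show "(B *\<^sub>v y) \<bullet>c (A *\<^sub>v (c \<cdot>\<^sub>v w)) = 0"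
      if "w \<in> carrier_vec n" "(B *\<^sub>v y) \<bullet>c (A *\<^sub>v w) = 0" for c w
      using that carrier By by (simp add: mult_mat_vec[OF A] conjugate_smult_vec scalar_prod_smult_distrib[of _ n])
  qed
qed

section \<open>Orthogonality of damped superpositions\<close>

lemma damping_ops_carrier:
  assumes "length ks = m"
  shows "damping_ops \<gamma> N ks \<in> carrier_mat ((N + 1) ^ m) ((N + 1) ^ m)"
  using assms
  by (auto simp: damping_ops_def dim_tensor_mats damping_op_def o_def map_replicate_const)

lemma number_state_carrier:
  assumes "length u = m"
  shows "number_state N u \<in> carrier_vec ((N + 1) ^ m)"
  using assms
  by (intro carrier_vecI) (auto simp: number_state_def dim_tensor_vecs o_def map_replicate_const)

theorem theorem7:
  fixes m t NT N :: nat and \<gamma> :: real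
    and Q1 Q2 :: "nat list set" and c1 c2 :: "complex vec"
  assumes "m \<ge> 1" and "N \<ge> NT" and "0 < \<gamma>" and "\<gamma> < 1"
    and "Q1 \<subseteq> number_tuples NT m" and "Q2 \<subseteq> number_tuples NT m"
    and "\<forall>u1\<in>Q1. \<forall>u2\<in>Q2. tuple_dist u1 u2 > real t"
    and "c1 \<in> superpositions N m Q1" and "c2 \<in> superpositions N m Q2"
  shows "\<forall>k \<in> (\<Union>s\<le>t. error_indices N m s). \<forall>k' \<in> (\<Union>s\<le>t. error_indices N m s).
    braket c1 ((mat_adjoint (damping_ops \<gamma> N k) * damping_ops \<gamma> N k') *\<^sub>v c2) = 0"
proof (intro ballI)
  fix k k'
  assume "k \<in> (\<Union>s\<le>t. error_indices N m s)" and "k' \<in> (\<Union>s\<le>t. error_indices N m s)"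
  then have k: "length k = m" "sum_list k \<le> t" and k': "length k' = m" "sum_list k' \<le> t"
    by (auto simp: error_indices_def)
  let ?n = "(N + 1) ^ m" and ?A = "damping_ops \<gamma> N k" and ?B = "damping_ops \<gamma> N k'"
  have A: "?A \<in> carrier_mat ?n ?n" and B: "?B \<in> carrier_mat ?n ?n"
    using k k' damping_ops_carrier by auto
  have len: "length u = m" if "u \<in> Q1 \<union> Q2" for u
    using assms(5,6) that by (auto simp: number_tuples_def)
  then have S: "number_state N ` Q1 \<subseteq> carrier_vec ?n" and T: "number_state N ` Q2 \<subseteq> carrier_vec ?n"
    using number_state_carrier by blast+
  note c1 = assms(8)[unfolded superpositions_def] and c2 = assms(9)[unfolded superpositions_def]
  have carrier: "c1 \<in> carrier_vec ?n" "c2 \<in> carrier_vec ?n"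
    using span_inductive[OF c1 S, of "\<lambda>x. x \<in> carrier_vec ?n"]
      span_inductive[OF c2 T, of "\<lambda>x. x \<in> carrier_vec ?n"] S T by auto
  have "(?B *\<^sub>v w) \<bullet>c (?A *\<^sub>v v) = 0" if "v \<in> number_state N ` Q1" "w \<in> number_state N ` Q2" for v w
  proof (rule ccontr)
    assume nz: "(?B *\<^sub>v w) \<bullet>c (?A *\<^sub>v v) \<noteq> 0"
    obtain u1 u2 where u: "u1 \<in> Q1" "v = number_state N u1" "u2 \<in> Q2" "w = number_state N u2"
      using \<open>v \<in> _\<close> \<open>w \<in> _\<close> by blast
    then have "2 * tuple_dist u1 u2 \<le> real (sum_list k + sum_list k')"
      using nz k k' len by (intro tuple_dist_le_if_damped_overlap) auto
    \<comment> \<open>Each of the two error patterns has total at most \<open>t\<close>, so the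
      distance is at most \<open>t\<close>, against the strict separation of \<open>Q1\<close> and
      \<open>Q2\<close>.\<close>
    also have "\<dots> \<le> 2 * real t"
      using k k' by simp
    finally show False
      using assms(7) u by force
  qed
  then have "(?B *\<^sub>v c2) \<bullet>c (?A *\<^sub>v c1) = 0"
    using span_orthogonal_images[OF A B S T _ c1 c2] by blast
  \<comment> \<open>Reassociating the product leaves \<open>mat_adjoint ?A\<close> outermost, where
    \<open>cscalar_prod_mat_adjoint\<close> can move it onto \<open>c1\<close> as
    \<open>?A\<close>.\<close>
  moreover have "mat_adjoint ?A \<in> carrier_mat ?n ?n"
    using A by (auto simp: mat_adjoint_def)
  then have "(mat_adjoint ?A * ?B) *\<^sub>v c2 = mat_adjoint ?A *\<^sub>v (?B *\<^sub>v c2)"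
    using B carrier(2) by (rule assoc_mult_mat_vec)
  ultimately show "braket c1 ((mat_adjoint ?A * ?B) *\<^sub>v c2) = 0"
    using cscalar_prod_mat_adjoint[OF A mult_mat_vec_carrier[OF B carrier(2)] carrier(1)]
    by (simp add: braket_def)
qed

end
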